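(* For $n\ge0$ let $S_n$ be the number of subsets of $\{1,\ldots,n\}$ such that no two elements of the subset differ by an element of $\{1,5\}$. Then, as formal power series, $$\sum_{n\ge0}S_nx^n=\frac{1+2x+2x^2+2x^3+2x^4+4x^5+3x^6+2x^7+x^8+x^9}{1-x^2-x^3-x^4+x^5-x^6-x^7-x^8-x^{10}}.$$
   Context: The empty subset is counted, and for $n=0$ the set $\{1,\ldots,n\}$ is empty, so $S_0=1$. *)

theory Defs
  imports "HOL-Computational_Algebra.Formal_Power_Series"
begin

definition S :: "nat \<Rightarrow> nat" where
  "S n = card {A. A \<subseteq> {1..n} \<and> (\<forall>i\<in>A. \<forall>j\<in>A. \<bar>int i - int j\<bar> \<notin> {1, 5})}"

end

theory Submission
  imports Defs
begin

text \<open>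
  The count is a transfer-matrix computation.  Decide membership of \<open>n, n - 1, \<dots>\<close> from the top
  downwards.  The only thing that the choices made so far impose on the remaining elements is
  which of them have become forbidden, and only the distances of the forbidden elements from the
  current top matter.  Leaving the top out moves the forbidden distances down by one; putting it in
  (possible if distance 0 is not forbidden) moves them down and forbids in addition the distances
  \<open>q - 1\<close> for each excluded difference \<open>q\<close>.  In terms of generating functions this is the linear
  equation of lemma \<open>avoid_fps_eq\<close>.

  For the differences 1 and 5, only eleven sets of forbidden distances are reachable from the empty
  set, so the generating functions satisfy eleven linear equations over the power series ring.
  Eliminating all unknowns but the series of \<open>S\<close> gives the claim, multiplied on both sides by
  \<open>1 - x\<close>; this factor is cancelled at the end.
\<close>

section \<open>Deciding membership from the top\<close>

text \<open>
  \<open>Q\<close> holds the excluded differences. \<open>F\<close> is the memory of the process: distances are taken from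
  the moving top \<open>n\<close>, so that the same finitely many \<open>F\<close> serve for every \<open>n\<close>.
\<close>

definition avoiding_sets :: "nat set \<Rightarrow> nat \<Rightarrow> nat set \<Rightarrow> nat set set" where
  "avoiding_sets Q n F =
     {A. A \<subseteq> {1..n} \<and> (\<forall>i\<in>A. \<forall>q\<in>Q. i + q \<notin> A) \<and> (\<forall>a\<in>A. n - a \<notin> F)}"

text \<open>
  Change of the forbidden distances when the top moves down by one; distance 0 belongs to the old
  top and is dropped.  The image form can be computed by rewriting on explicit finite sets.
\<close>

definition shift_down :: "nat set \<Rightarrow> nat set" where
  "shift_down F = (\<lambda>k. k - 1) ` (F - {0})"

lemma mem_shift_down_iff: "k \<in> shift_down F \<longleftrightarrow> Suc k \<in> F"
proof
  assume "Suc k \<in> F"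
  then have "Suc k - 1 \<in> shift_down F" unfolding shift_down_def by blast
  then show "k \<in> shift_down F" by simp
next
  assume "k \<in> shift_down F"
  then obtain x where "x \<in> F" "x \<noteq> 0" "k = x - 1" by (auto simp: shift_down_def)
  then show "Suc k \<in> F" by simp
qed

lemma finite_avoiding_sets: "finite (avoiding_sets Q n F)"
  by (rule finite_subset[of _ "Pow {1..n}"]) (auto simp: avoiding_sets_def)

lemma avoiding_sets_0: "avoiding_sets Q 0 F = {{}}"
  by (auto simp: avoiding_sets_def)

lemma avoiding_sets_Suc_without_top:
  "{A \<in> avoiding_sets Q (Suc n) F. Suc n \<notin> A} = avoiding_sets Q n (shift_down F)"
proof -
  have sub: "A \<subseteq> {1..n} \<longleftrightarrow> A \<subseteq> {1..Suc n} \<and> Suc n \<notin> A" for A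
    by (auto simp: atLeastAtMostSuc_conv)
  have dist: "(\<forall>a\<in>A. Suc n - a \<notin> F) \<longleftrightarrow> (\<forall>a\<in>A. n - a \<notin> shift_down F)"
    if "A \<subseteq> {1..n}" for A
  proof (rule ball_cong[OF refl])
    fix a assume "a \<in> A"
    with that have "a \<le> n" by auto
    then show "Suc n - a \<notin> F \<longleftrightarrow> n - a \<notin> shift_down F"
      by (simp add: mem_shift_down_iff Suc_diff_le)
  qed
  show ?thesis
  proof (rule set_eqI)
    fix A
    show "A \<in> {A \<in> avoiding_sets Q (Suc n) F. Suc n \<notin> A} \<longleftrightarrow>
        A \<in> avoiding_sets Q n (shift_down F)"
      using sub[of A] dist[of A] by (simp only: avoiding_sets_def mem_Collect_eq) metis
  qed
qed

text \<open>
  Once \<open>n + 1\<close> is in the set, an element \<open>b \<le> n\<close> is ruled out as a partner of \<open>n + 1\<close> exactly if its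
  distance \<open>n + 1 - b\<close> lies in \<open>Q\<close>; so \<open>Q\<close> joins the forbidden distances before the shift.  The
  hypothesis on \<open>Q\<close> keeps \<open>n + 1\<close> from conflicting with itself.
\<close>

lemma avoiding_sets_Suc_with_top:
  assumes "0 \<notin> Q" and "0 \<notin> F"
  shows "{A \<in> avoiding_sets Q (Suc n) F. Suc n \<in> A} =
    insert (Suc n) ` avoiding_sets Q n (shift_down (F \<union> Q))"
    (is "?L = ?R")
proof (rule set_eqI, rule iffI)
  fix A assume A: "A \<in> ?L"
  have "A - {Suc n} \<in> avoiding_sets Q n (shift_down (F \<union> Q))"
  proof -
    have "n - a \<notin> shift_down (F \<union> Q)" if a: "a \<in> A - {Suc n}" for a
    proof -
      from a A have le: "a \<le> n" by (force simp: avoiding_sets_def)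
      then have eq: "Suc (n - a) = Suc n - a" "a + (Suc n - a) = Suc n" by auto
      have "Suc n - a \<notin> F" using a A by (auto simp: avoiding_sets_def)
      moreover have "Suc n - a \<notin> Q"
        using a A eq(2) by (force simp: avoiding_sets_def)
      ultimately show ?thesis using eq(1) by (simp add: mem_shift_down_iff)
    qed
    moreover have "A - {Suc n} \<subseteq> {1..n}"
      using A by (force simp: avoiding_sets_def)
    ultimately show ?thesis using A by (auto simp: avoiding_sets_def)
  qed
  moreover have "A = insert (Suc n) (A - {Suc n})" using A by auto
  ultimately show "A \<in> ?R" by blast
next
  fix A assume "A \<in> ?R"
  then obtain B where A: "A = insert (Suc n) B"
    and B: "B \<in> avoiding_sets Q n (shift_down (F \<union> Q))" by blast
  have le: "1 \<le> b \<and> b \<le> n" if "b \<in> B" for b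
    using B that by (auto simp: avoiding_sets_def)
  have far: "Suc n - b \<notin> F \<union> Q" if "b \<in> B" for b
  proof -
    have "n - b \<notin> shift_down (F \<union> Q)" using B that by (auto simp: avoiding_sets_def)
    then show ?thesis using le[OF that] by (simp add: mem_shift_down_iff Suc_diff_le)
  qed
  have "i + q \<notin> A" if i: "i \<in> A" and q: "q \<in> Q" for i q
  proof
    assume iq: "i + q \<in> A"
    have "q > 0" using q assms(1) by (cases q) auto
    have "i \<in> B" using i iq le \<open>q > 0\<close> A by force
    show False
    proof (cases "i + q = Suc n")
      case True
      then have "Suc n - i = q" by simp
      then show False using far[OF \<open>i \<in> B\<close>] q by simp
    next
      case False
      then show False using iq A B \<open>i \<in> B\<close> q by (auto simp: avoiding_sets_def)
    qed
  qed
  moreover have "A \<subseteq> {1..Suc n}" using A le by fastforce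
  moreover have "Suc n - a \<notin> F" if "a \<in> A" for a
    using that A far assms(2) by auto
  ultimately show "A \<in> ?L" using A by (auto simp: avoiding_sets_def)
qed

lemma card_avoiding_sets_Suc:
  assumes "0 \<notin> Q"
  shows "card (avoiding_sets Q (Suc n) F) =
    card (avoiding_sets Q n (shift_down F)) +
    (if 0 \<in> F then 0 else card (avoiding_sets Q n (shift_down (F \<union> Q))))"
proof -
  let ?out = "{A \<in> avoiding_sets Q (Suc n) F. Suc n \<notin> A}"
  let ?in = "{A \<in> avoiding_sets Q (Suc n) F. Suc n \<in> A}"
  have "avoiding_sets Q (Suc n) F = ?out \<union> ?in" by blast
  then have "card (avoiding_sets Q (Suc n) F) = card (?out \<union> ?in)" by simp
  also have "\<dots> = card ?out + card ?in"
    by (rule card_Un_disjoint) (auto simp: finite_avoiding_sets)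
  also have "card ?in =
      (if 0 \<in> F then 0 else card (avoiding_sets Q n (shift_down (F \<union> Q))))"
  proof (cases "0 \<in> F")
    case True
    have "Suc n \<notin> A" if "A \<in> avoiding_sets Q (Suc n) F" for A
      using that True by (auto simp: avoiding_sets_def dest!: bspec[where x = "Suc n"])
    then have "?in = {}" by blast
    then have "card ?in = 0" by (simp only: card.empty)
    then show ?thesis using True by (simp only: if_True)
  next
    case False
    have "inj_on (insert (Suc n)) (avoiding_sets Q n (shift_down (F \<union> Q)))"
    proof (rule inj_onI)
      fix B C
      assume "B \<in> avoiding_sets Q n (shift_down (F \<union> Q))"
        and "C \<in> avoiding_sets Q n (shift_down (F \<union> Q))"
        and eq: "insert (Suc n) B = insert (Suc n) C"
      then have "Suc n \<notin> B" "Suc n \<notin> C" by (auto simp: avoiding_sets_def)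
      then show "B = C" using eq by (metis insert_ident)
    qed
    then show ?thesis
      using False by (simp add: avoiding_sets_Suc_with_top[OF assms False] card_image)
  qed
  finally show ?thesis by (simp add: avoiding_sets_Suc_without_top)
qed

section \<open>Generating functions\<close>

definition avoid_fps :: "nat set \<Rightarrow> nat set \<Rightarrow> rat fps" where
  "avoid_fps Q F = Abs_fps (\<lambda>n. of_nat (card (avoiding_sets Q n F)))"

lemma avoid_fps_eq:
  assumes "0 \<notin> Q"
  shows "avoid_fps Q F = 1 + fps_X * (avoid_fps Q (shift_down F) +
    (if 0 \<in> F then 0 else avoid_fps Q (shift_down (F \<union> Q))))"
proof (rule fps_ext)
  fix n
  show "fps_nth (avoid_fps Q F) n = fps_nth (1 + fps_X * (avoid_fps Q (shift_down F) +
    (if 0 \<in> F then 0 else avoid_fps Q (shift_down (F \<union> Q))))) n"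
    by (cases n) (simp_all add: avoid_fps_def avoiding_sets_0 card_avoiding_sets_Suc[OF assms])
qed

lemma S_eq_card_avoiding_sets: "S n = card (avoiding_sets {1, 5} n {})"
proof -
  have "(\<forall>i\<in>A. \<forall>j\<in>A. \<bar>int i - int j\<bar> \<notin> {1, 5}) \<longleftrightarrow> (\<forall>i\<in>A. \<forall>q\<in>{1, 5}. i + q \<notin> A)" for A
  proof
    assume *: "\<forall>i\<in>A. \<forall>j\<in>A. \<bar>int i - int j\<bar> \<notin> {1, 5}"
    show "\<forall>i\<in>A. \<forall>q\<in>{1, 5}. i + q \<notin> A"
    proof (intro ballI notI)
      fix i q assume "i \<in> A" "q \<in> {1, 5::nat}" "i + q \<in> A"
      then show False using *[rule_format, of i "i + q"] by auto
    qed
  next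
    assume *: "\<forall>i\<in>A. \<forall>q\<in>{1, 5}. i + q \<notin> A"
    show "\<forall>i\<in>A. \<forall>j\<in>A. \<bar>int i - int j\<bar> \<notin> {1, 5}"
    proof (intro ballI notI)
      fix i j assume ij: "i \<in> A" "j \<in> A" "\<bar>int i - int j\<bar> \<in> {1, 5}"
      then consider "j = i + 1" | "i = j + 1" | "j = i + 5" | "i = j + 5" by force
      then show False using * ij by cases auto
    qed
  qed
  then show ?thesis by (simp add: S_def avoiding_sets_def)
qed

section \<open>The differences 1 and 5\<close>

text \<open>
  Elimination in the system for the eleven reachable states.  The unknown of a state carries its
  forbidden distances in its name: \<open>g024\<close> belongs to \<open>{0, 2, 4}\<close>, and \<open>g\<close> to the empty set.
\<close>

lemma solve_state_equations:
  fixes x g :: "'a :: idom"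
  assumes "g = 1 + x * (g + g04)"
    and "g04 = 1 + x * g3"
    and "g3 = 1 + x * (g2 + g024)"
    and "g2 = 1 + x * (g1 + g014)"
    and "g024 = 1 + x * g13"
    and "g1 = 1 + x * (g0 + g04)"
    and "g014 = 1 + x * g03"
    and "g13 = 1 + x * (g02 + g024)"
    and "g0 = 1 + x * g"
    and "g03 = 1 + x * g2"
    and "g02 = 1 + x * g1"
  shows "(1 - x) * (g * (1 - x^2 - x^3 - x^4 + x^5 - x^6 - x^7 - x^8 - x^10)) =
    (1 - x) * (1 + 2 * x + 2 * x^2 + 2 * x^3 + 2 * x^4 + 4 * x^5 + 3 * x^6 + 2 * x^7 + x^8 + x^9)"
    (is "_ * (_ * ?D) = _ * ?N")
proof -
  let ?P = "(1 - x^2) * (1 - x^3)"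
  let ?Q = "x^2 * (1 - x^2) + x^4 * (1 - x^3)"
  let ?R = "?P * (1 + x) + x * (1 - x^2) * (1 + x + x^2) + x^2 * (1 - x^3) * (1 + 2 * x)"
  note ring = algebra_simps eval_nat_numeral
  \<comment> \<open>The cycles \<open>{2}, {0, 1, 4}, {0, 3}\<close> and \<open>{1, 3}, {0, 2, 4}\<close> of states have length 3 and 2,
    whence the two factors of \<open>?P\<close>.  Solving for their members leaves \<open>g\<close>, \<open>g1\<close> and \<open>g3\<close>.\<close>
  have "g2 - x^3 * g2 = 1 + x + x^2 + x * g1"
  proof -
    have "g2 = 1 + x * (g1 + (1 + x * (1 + x * g2)))" using assms(4,7,10) by simp
    also have "\<dots> = 1 + x + x^2 + x * g1 + x^3 * g2" by (simp add: ring)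
    finally show ?thesis by (simp only: diff_eq_eq)
  qed
  then have g2: "(1 - x^3) * g2 = 1 + x + x^2 + x * g1" by (simp add: left_diff_distrib)
  have "g13 - x^2 * g13 = 1 + 2 * x + x^2 * g1"
  proof -
    have "g13 = 1 + x * ((1 + x * g1) + (1 + x * g13))" using assms(5,8,11) by simp
    also have "\<dots> = 1 + 2 * x + x^2 * g1 + x^2 * g13" by (simp add: ring)
    finally show ?thesis by (simp only: diff_eq_eq)
  qed
  then have g13: "(1 - x^2) * g13 = 1 + 2 * x + x^2 * g1" by (simp add: left_diff_distrib)
  have g1: "g1 = 1 + 2 * x + x^2 * g + x^2 * g3"
  proof -
    have "g1 = 1 + x * ((1 + x * g) + (1 + x * g3))" using assms(2,6,9) by simp
    then show ?thesis by (simp add: ring)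
  qed
  have "g - x * g = 1 + x + x^2 * g3"
  proof -
    have "g = 1 + x * (g + (1 + x * g3))" using assms(1,2) by simp
    also have "\<dots> = 1 + x + x^2 * g3 + x * g" by (simp add: ring)
    finally show ?thesis by (simp only: diff_eq_eq)
  qed
  then have g: "(1 - x) * g = 1 + x + x^2 * g3" by (simp add: left_diff_distrib)
  \<comment> \<open>Multiplying by \<open>?P\<close> lets \<open>g2\<close> and \<open>g13\<close> be replaced without division.\<close>
  have "g3 = 1 + x * (g2 + (1 + x * g13))" using assms(3,5) by simp
  then have "?P * g3 = ?P * (1 + x * (g2 + (1 + x * g13)))" by (rule arg_cong)
  also have "\<dots> = ?P * (1 + x) + x * (1 - x^2) * ((1 - x^3) * g2)
      + x^2 * (1 - x^3) * ((1 - x^2) * g13)" by (simp add: ring)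
  also have "\<dots> = ?R + ?Q * g1" unfolding g2 g13 by (simp add: ring)
  also have "\<dots> = ?R + ?Q * (1 + 2 * x + x^2 * g) + x^2 * ?Q * g3"
    by (subst g1) (simp add: ring)
  finally have "?P * g3 - x^2 * ?Q * g3 = ?R + ?Q * (1 + 2 * x + x^2 * g)"
    by (simp only: diff_eq_eq)
  then have g3: "(?P - x^2 * ?Q) * g3 = ?R + ?Q * (1 + 2 * x + x^2 * g)"
    by (simp only: left_diff_distrib)
  have "(?P - x^2 * ?Q) * ((1 - x) * g) =
      (?P - x^2 * ?Q) * (1 + x) + x^2 * ((?P - x^2 * ?Q) * g3)"
    unfolding g by (simp add: ring)
  also have "\<dots> =
      (?P - x^2 * ?Q) * (1 + x) + x^2 * (?R + ?Q * (1 + 2 * x)) + x^4 * ?Q * g"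
    unfolding g3 by (simp add: ring)
  finally have elim: "(?P - x^2 * ?Q) * ((1 - x) * g) - x^4 * ?Q * g =
      (?P - x^2 * ?Q) * (1 + x) + x^2 * (?R + ?Q * (1 + 2 * x))"
    by (simp only: diff_eq_eq)
  have D: "(?P - x^2 * ?Q) * (1 - x) - x^4 * ?Q = (1 - x) * ?D"
    by algebra
  have N: "(?P - x^2 * ?Q) * (1 + x) + x^2 * (?R + ?Q * (1 + 2 * x)) = (1 - x) * ?N"
    by algebra
  have "(1 - x) * (g * ?D) = ((1 - x) * ?D) * g"
    by (simp only: mult_ac)
  also have "\<dots> = ((?P - x^2 * ?Q) * (1 - x) - x^4 * ?Q) * g"
    by (simp only: D)
  also have "\<dots> = (?P - x^2 * ?Q) * ((1 - x) * g) - x^4 * ?Q * g"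
    by (rule trans[OF left_diff_distrib]) (simp only: mult.assoc)
  also have "\<dots> = (1 - x) * ?N"
    by (rule trans[OF elim N])
  finally show ?thesis .
qed

theorem proposition10:
  shows "Abs_fps (\<lambda>n. of_nat (S n) :: rat) =
    (1 + 2 * fps_X + 2 * fps_X^2 + 2 * fps_X^3 + 2 * fps_X^4 + 4 * fps_X^5
       + 3 * fps_X^6 + 2 * fps_X^7 + fps_X^8 + fps_X^9)
    / (1 - fps_X^2 - fps_X^3 - fps_X^4 + fps_X^5 - fps_X^6 - fps_X^7 - fps_X^8 - fps_X^10)"
    (is "?S = ?N / ?D")
proof -
  let ?G = "avoid_fps {1, 5}"
  have step: "?G F = 1 + fps_X * (?G (shift_down F) +
      (if 0 \<in> F then 0 else ?G (shift_down (F \<union> {1, 5}))))" for F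
    by (rule avoid_fps_eq) simp
  have S: "?S = ?G {}"
    by (simp add: avoid_fps_def S_eq_card_avoiding_sets)
  \<comment> \<open>Sets containing \<open>1, 5\<close> arise as unions with the excluded differences, and are listed in the
    order, and with the repetitions, that simplifying the union yields.\<close>
  have set_simps: "shift_down {} = {}" "shift_down {1, 5} = {0, 4}"
    "shift_down {0, 4} = {3}" "shift_down {3} = {2}" "shift_down {1, 5, 3} = {0, 2, 4}"
    "shift_down {2} = {1}" "shift_down {1, 5, 2} = {0, 1, 4}"
    "shift_down {0, 2, 4} = {1, 3}" "shift_down {1} = {0}" "shift_down {0, 1, 4} = {0, 3}"
    "shift_down {1, 3} = {0, 2}" "shift_down {1, 5, 1} = {0, 4}"
    "shift_down {1, 5, 1, 3} = {0, 2, 4}"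
    "shift_down {0} = {}" "shift_down {0, 3} = {2}" "shift_down {0, 2} = {1}"
    by (auto simp: shift_down_def)
  have eq: "(1 - fps_X) * (?G {} * ?D) = (1 - fps_X) * ?N"
  proof (rule solve_state_equations)
    show "?G {} = 1 + fps_X * (?G {} + ?G {0, 4})"
      by (rule trans[OF step]) (simp add: set_simps del: One_nat_def)
    show "?G {0, 4} = 1 + fps_X * ?G {3}"
      by (rule trans[OF step]) (simp add: set_simps del: One_nat_def)
    show "?G {3} = 1 + fps_X * (?G {2} + ?G {0, 2, 4})"
      by (rule trans[OF step]) (simp add: set_simps del: One_nat_def)
    show "?G {2} = 1 + fps_X * (?G {1} + ?G {0, 1, 4})"
      by (rule trans[OF step]) (simp add: set_simps del: One_nat_def)
    show "?G {0, 2, 4} = 1 + fps_X * ?G {1, 3}"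
      by (rule trans[OF step]) (simp add: set_simps del: One_nat_def)
    show "?G {1} = 1 + fps_X * (?G {0} + ?G {0, 4})"
      by (rule trans[OF step]) (simp add: set_simps del: One_nat_def)
    show "?G {0, 1, 4} = 1 + fps_X * ?G {0, 3}"
      by (rule trans[OF step]) (simp add: set_simps del: One_nat_def)
    show "?G {1, 3} = 1 + fps_X * (?G {0, 2} + ?G {0, 2, 4})"
      by (rule trans[OF step]) (simp add: set_simps del: One_nat_def)
    show "?G {0} = 1 + fps_X * ?G {}"
      by (rule trans[OF step]) (simp add: set_simps del: One_nat_def)
    show "?G {0, 3} = 1 + fps_X * ?G {2}"
      by (rule trans[OF step]) (simp add: set_simps del: One_nat_def)
    show "?G {0, 2} = 1 + fps_X * ?G {1}"
      by (rule trans[OF step]) (simp add: set_simps del: One_nat_def)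
  qed
  have nz: "(1 - fps_X :: rat fps) \<noteq> 0"
    by (metis fps_X_neq_one right_minus_eq)
  have "?G {} * ?D = ?N"
    by (rule iffD1[OF mult_left_cancel[OF nz] eq])
  then have N: "?N = ?S * ?D" by (simp only: S)
  have "?D \<noteq> 0"
  proof
    assume "?D = (0 :: rat fps)"
    then have "fps_nth ?D 0 = (0 :: rat)" by (simp only: fps_zero_nth)
    then show False by simp
  qed
  then have "?S * ?D / ?D = ?S" by (rule nonzero_mult_div_cancel_right)
  then show ?thesis by (simp only: N)
qed

end
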